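(* For $n\ge0$ let $S_n$ be the number of subsets of $\{1,\ldots,n\}$ such that no two elements of the subset differ by an element of $\{1,6\}$. Then, as formal power series, $\sum_{n\ge0}S_nx^n=A(x)/D(x)$, where $$A(x)=1+x+x^2+2x^3+2x^4+2x^5+5x^6+3x^8+2x^9-x^{10}+x^{11}-4x^{12}-x^{13}-2x^{14}-2x^{15}-x^{17},$$ $$D(x)=1-x-x^4-x^5+2x^6-4x^7+2x^8-2x^{10}+2x^{11}-4x^{12}+3x^{13}-x^{14}+2x^{16}-x^{17}+x^{18}.$$
   Context: The empty subset is counted, and for $n=0$ the set $\{1,\ldots,n\}$ is empty, so $S_0=1$. *)

theory Defs
  imports "HOL-Computational_Algebra.Computational_Algebra"
begin

(* Differences are taken in int, so that subtraction on nat does not truncate. *)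
definition admissible_subsets :: "nat \<Rightarrow> nat set set" where
  "admissible_subsets n =
     {B. B \<subseteq> {1..n} \<and> (\<forall>x\<in>B. \<forall>y\<in>B. \<bar>int x - int y\<bar> \<notin> {1, 6})}"

definition S_count :: "nat \<Rightarrow> nat" where
  "S_count n = card (admissible_subsets n)"

definition A_fps :: "rat fps" where
  "A_fps = 1 + fps_X + fps_X^2 + 2 * fps_X^3 + 2 * fps_X^4 + 2 * fps_X^5 + 5 * fps_X^6
     + 3 * fps_X^8 + 2 * fps_X^9 - fps_X^10 + fps_X^11 - 4 * fps_X^12 - fps_X^13
     - 2 * fps_X^14 - 2 * fps_X^15 - fps_X^17"

(* The constant term is 1, so D_fps is a unit and division by it is the true quotient. *)
definition D_fps :: "rat fps" where
  "D_fps = 1 - fps_X - fps_X^4 - fps_X^5 + 2 * fps_X^6 - 4 * fps_X^7 + 2 * fps_X^8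
     - 2 * fps_X^10 + 2 * fps_X^11 - 4 * fps_X^12 + 3 * fps_X^13 - fps_X^14
     + 2 * fps_X^16 - fps_X^17 + fps_X^18"

end

theory Submission
  imports Defs
begin

text \<open>
  The idea is to build an admissible set from its smallest possible element upwards, remembering
  only which small numbers have become forbidden. For a set \<open>W\<close> of forbidden numbers, let
  \<open>F W\<close> be the generating function that counts the admissible subsets of \<open>{1..n}\<close> disjoint from
  \<open>W\<close>. Deciding whether the number 1 is chosen and then shifting everything down by 1 expresses
  \<open>F W\<close> through \<open>F (W - 1)\<close> and, if 1 is allowed, \<open>F ((W - 1) \<union> {1, 6})\<close>, because after the shift
  the chosen element sits at 0 and forbids exactly 1 and 6 (lemmas \<open>gf_avoiding_allowed\<close> and
  \<open>gf_avoiding_forbidden\<close>).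

  Starting from \<open>W = {}\<close>, only 18 sets \<open>W\<close> are reachable, all inside \<open>{1..6}\<close>; this is the degree
  of the denominator. Whenever \<open>1 \<in> W\<close>, the step is forced and \<open>F W\<close> is immediately eliminated,
  which leaves a linear system of eight equations for the eight reachable \<open>W\<close> that do not
  contain 1. The determinant of that system is \<open>D\<close>, and Cramer's rule gives \<open>D * F {} = A\<close>
  (lemma \<open>cramer_identity\<close>).
\<close>

definition avoiding :: "nat \<Rightarrow> nat set \<Rightarrow> nat set set" where
  "avoiding n W = {B \<in> admissible_subsets n. B \<inter> W = {}}"

definition gf_avoiding :: "nat set \<Rightarrow> rat fps" where
  "gf_avoiding W = Abs_fps (\<lambda>n. of_nat (card (avoiding n W)))"

lemma finite_avoiding: "finite (avoiding n W)"
  by (rule finite_subset[of _ "Pow {1..n}"]) (auto simp: avoiding_def admissible_subsets_def)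

lemma card_avoiding_0: "card (avoiding 0 W) = 1"
proof -
  have "avoiding 0 W = {{}}"
    by (auto simp: avoiding_def admissible_subsets_def)
  then show ?thesis by simp
qed

lemma zero_notin_avoiding: "B \<in> avoiding n W \<Longrightarrow> 0 \<notin> B"
  by (auto simp: avoiding_def admissible_subsets_def)

text \<open>After the shift, the chosen number 1 becomes 0, and the numbers at distance 1 or 6
  from it are 1 and 6.\<close>

lemma admissible_insert_1_iff:
  assumes "0 \<notin> B"
  shows "insert 1 (Suc ` B) \<in> admissible_subsets (Suc n) \<longleftrightarrow>
    B \<in> admissible_subsets n \<and> B \<inter> {1, 6} = {}"
proof -
  have "insert 1 (Suc ` B) \<subseteq> {1..Suc n} \<longleftrightarrow> B \<subseteq> {1..n}"
    using assms by (fastforce simp: subset_iff Suc_le_eq intro: gr0I)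
  moreover have "\<bar>int 1 - int (Suc y)\<bar> = int y" "\<bar>int (Suc y) - int 1\<bar> = int y" for y
    by auto
  ultimately show ?thesis
    by (auto simp: admissible_subsets_def)
qed

lemma admissible_Suc_image_iff:
  assumes "0 \<notin> B"
  shows "Suc ` B \<in> admissible_subsets (Suc n) \<longleftrightarrow> B \<in> admissible_subsets n"
proof -
  have "Suc ` B \<subseteq> {1..Suc n} \<longleftrightarrow> B \<subseteq> {1..n}"
    using assms by (fastforce simp: subset_iff Suc_le_eq intro: gr0I)
  then show ?thesis
    by (auto simp: admissible_subsets_def)
qed

lemma admissible_Suc_cases:
  assumes "B \<in> admissible_subsets (Suc n)"
  obtains (without) C where "0 \<notin> C" "B = Suc ` C"
    | ("with") C where "0 \<notin> C" "B = insert 1 (Suc ` C)"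
proof -
  define C where "C = Suc -` B - {0}"
  have "0 \<notin> B"
    using assms by (auto simp: admissible_subsets_def)
  then have "B \<subseteq> range Suc"
    by (metis not0_implies_Suc rangeI subsetI)
  then have "B - {1} = Suc ` C"
    by (auto simp: C_def)
  moreover have "0 \<notin> C"
    by (simp add: C_def)
  ultimately show ?thesis
    using that[of C] insert_Diff[of 1 B] by (cases "1 \<in> B") simp_all
qed

lemma avoiding_Suc_forbidden:
  "avoiding (Suc n) (insert 1 (Suc ` W)) = image Suc ` avoiding n W" (is "?L = ?R")
proof (intro set_eqI iffI)
  fix B assume "B \<in> ?L"
  then have B: "B \<in> admissible_subsets (Suc n)" "B \<inter> insert 1 (Suc ` W) = {}"
    by (auto simp: avoiding_def)
  from B(1) show "B \<in> ?R"
  proof (cases rule: admissible_Suc_cases)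
    case (without C)
    then have "C \<in> avoiding n W"
      using B admissible_Suc_image_iff by (auto simp: avoiding_def)
    with without show ?thesis by blast
  next
    case ("with" C)
    with B show ?thesis by auto
  qed
next
  fix B assume "B \<in> ?R"
  then obtain C where C: "C \<in> avoiding n W" "B = Suc ` C" by auto
  with zero_notin_avoiding[OF C(1)] show "B \<in> ?L"
    using admissible_Suc_image_iff[of C n] by (auto simp: avoiding_def)
qed

lemma avoiding_Suc_allowed:
  assumes "0 \<notin> W"
  shows "avoiding (Suc n) (Suc ` W) =
    image Suc ` avoiding n W \<union> (\<lambda>B. insert 1 (Suc ` B)) ` avoiding n ({1, 6} \<union> W)"
    (is "?L = ?R1 \<union> ?R2")
proof (intro set_eqI iffI)
  fix B assume "B \<in> ?L"
  then have B: "B \<in> admissible_subsets (Suc n)" "B \<inter> Suc ` W = {}"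
    by (auto simp: avoiding_def)
  from B(1) show "B \<in> ?R1 \<union> ?R2"
  proof (cases rule: admissible_Suc_cases)
    case (without C)
    then have "C \<in> avoiding n W"
      using B admissible_Suc_image_iff by (auto simp: avoiding_def)
    with without show ?thesis by blast
  next
    case ("with" C)
    then have "C \<in> avoiding n ({1, 6} \<union> W)"
      using B admissible_insert_1_iff[of C n] by (auto simp: avoiding_def)
    with "with" show ?thesis by blast
  qed
next
  fix B assume "B \<in> ?R1 \<union> ?R2"
  then consider C where "C \<in> avoiding n W" "B = Suc ` C"
    | C where "C \<in> avoiding n ({1, 6} \<union> W)" "B = insert 1 (Suc ` C)" by auto
  then show "B \<in> ?L"
  proof cases
    case (1 C)
    with zero_notin_avoiding[OF 1(1)] show ?thesis
      using admissible_Suc_image_iff[of C n] by (auto simp: avoiding_def)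
  next
    case (2 C)
    with zero_notin_avoiding[OF 2(1)] show ?thesis
      using admissible_insert_1_iff[of C n] assms by (auto simp: avoiding_def)
  qed
qed

lemma card_avoiding_Suc_forbidden:
  "card (avoiding (Suc n) (insert 1 (Suc ` W))) = card (avoiding n W)"
  unfolding avoiding_Suc_forbidden by (intro card_image inj_onI) (simp add: inj_image_eq_iff)

lemma card_avoiding_Suc_allowed:
  assumes "0 \<notin> W"
  shows "card (avoiding (Suc n) (Suc ` W)) =
    card (avoiding n W) + card (avoiding n ({1, 6} \<union> W))"
proof -
  have inj1: "inj_on (image Suc) (avoiding n W)"
    by (intro inj_onI) (simp add: inj_image_eq_iff)
  have inj2: "inj_on (\<lambda>B. insert 1 (Suc ` B)) (avoiding n ({1, 6} \<union> W))"
  proof (intro inj_onI)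
    fix B C
    assume B: "B \<in> avoiding n ({1, 6} \<union> W)" and C: "C \<in> avoiding n ({1, 6} \<union> W)"
      and eq: "insert 1 (Suc ` B) = insert 1 (Suc ` C)"
    have "1 \<notin> Suc ` B" "1 \<notin> Suc ` C"
      using zero_notin_avoiding[OF B] zero_notin_avoiding[OF C] by auto
    with eq have "Suc ` B = Suc ` C"
      using insert_ident by metis
    then show "B = C"
      by (simp add: inj_image_eq_iff)
  qed
  have "image Suc ` avoiding n W \<inter>
      (\<lambda>B. insert 1 (Suc ` B)) ` avoiding n ({1, 6} \<union> W) = {}"
  proof -
    have "1 \<notin> Suc ` B" if "B \<in> avoiding n W" for B
      using zero_notin_avoiding[OF that] by auto
    then show ?thesis by blast
  qed
  then show ?thesis
    unfolding avoiding_Suc_allowed[OF assms]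
    using inj1 inj2 by (simp add: card_Un_disjoint finite_avoiding card_image)
qed

lemma gf_avoiding_forbidden:
  "gf_avoiding (insert 1 (Suc ` W)) = 1 + fps_X * gf_avoiding W"
proof (rule fps_ext)
  fix n
  show "fps_nth (gf_avoiding (insert 1 (Suc ` W))) n = fps_nth (1 + fps_X * gf_avoiding W) n"
    using card_avoiding_Suc_forbidden[of _ W]
    by (cases n) (simp_all add: gf_avoiding_def card_avoiding_0)
qed

lemma gf_avoiding_allowed:
  assumes "0 \<notin> W"
  shows "gf_avoiding (Suc ` W) = 1 + fps_X * (gf_avoiding W + gf_avoiding ({1, 6} \<union> W))"
proof (rule fps_ext)
  fix n
  show "fps_nth (gf_avoiding (Suc ` W)) n =
      fps_nth (1 + fps_X * (gf_avoiding W + gf_avoiding ({1, 6} \<union> W))) n"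
    using card_avoiding_Suc_allowed[OF assms]
    by (cases n) (simp_all add: gf_avoiding_def card_avoiding_0)
qed

text \<open>
  Cramer's rule for the eight equations of the system, written as a single identity: the
  multipliers of the eight right-hand factors are the cofactors of the first column of the
  coefficient matrix, so all unknowns except \<open>e\<close> cancel. The unknowns stand for the generating
  functions of the forbidden sets \<open>{}\<close>, \<open>{5}\<close>, \<open>{4}\<close>, \<open>{3}\<close>, \<open>{2}\<close>, \<open>{3, 5}\<close>, \<open>{2, 5}\<close>,
  \<open>{2, 4}\<close>, in the order in which they are fixed.
\<close>

lemma cramer_identity:
  fixes x e d c b a p q r :: "'a :: comm_ring_1"
  shows "(1 - x - x^4 - x^5 + 2*x^6 - 4*x^7 + 2*x^8 - 2*x^10 + 2*x^11 - 4*x^12 + 3*x^13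
      - x^14 + 2*x^16 - x^17 + x^18) * e
    - (1 + x + x^2 + 2*x^3 + 2*x^4 + 2*x^5 + 5*x^6 + 3*x^8 + 2*x^9 - x^10 + x^11 - 4*x^12
      - x^13 - 2*x^14 - 2*x^15 - x^17) =
    (1 - x^4 - 2*x^5 - 3*x^7 - x^8 - x^10 + 2*x^11 - x^12 + x^13 + x^14 + x^16)
      * (e - (1 + x * (e + (1 + x*d))))
    + (x^2 - x^6 - x^7 - 2*x^9 + x^11 + x^13) * (d - (1 + x * (c + (1 + x*p))))
    + (x^3 - x^8 - x^10 + x^12 + x^14) * (c - (1 + x * (b + (1 + x*q))))
    + (x^4 + x^7) * (b - (1 + x * (a + (1 + x * (1 + x*c)))))
    + (x^5 + x^7 + x^8 + x^9 + x^10 - x^11 + x^12 - x^13 - x^14 - x^16)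
      * (a - (1 + x * ((1 + x*e) + (1 + x*d))))
    + (x^4 + x^7 - x^8 - x^11) * (p - (1 + x * (r + (1 + x * (1 + x*r)))))
    + (x^5 + x^7 + x^9 - x^11 - x^13) * (q - (1 + x * ((1 + x*b) + (1 + x*p))))
    + (x^5 + x^7 + x^8 - x^9 + x^10 - x^11 - x^12 - x^14)
      * (r - (1 + x * ((1 + x*a) + (1 + x*q))))"
  \<comment> \<open>merging products of powers of \<open>x\<close> cancels almost all of the several hundred terms;
    unfolding the exponents from the start would make the expansion much larger\<close>
  by (simp add: algebra_simps flip: power_add power_Suc) (simp add: algebra_simps eval_nat_numeral)

theorem proposition11:
  shows "Abs_fps (\<lambda>n. of_nat (S_count n) :: rat) = A_fps / D_fps"
proof -
  let ?F = gf_avoiding and ?x = "fps_X :: rat fps"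
  have F0: "Abs_fps (\<lambda>n. of_nat (S_count n) :: rat) = ?F {}"
    by (simp add: gf_avoiding_def avoiding_def S_count_def)
  \<comment> \<open>the ten reachable sets that contain 1, where the step is forced\<close>
  have f1: "?F {1} = 1 + ?x * ?F {}"
    using gf_avoiding_forbidden[of "{}"] by simp
  have f13: "?F {1,3} = 1 + ?x * ?F {2}"
    using gf_avoiding_forbidden[of "{2}"] by simp
  have f14: "?F {1,4} = 1 + ?x * ?F {3}"
    using gf_avoiding_forbidden[of "{3}"] by simp
  have f15: "?F {1,5} = 1 + ?x * ?F {4}"
    using gf_avoiding_forbidden[of "{4}"] by simp
  have f16: "?F {1,6} = 1 + ?x * ?F {5}"
    using gf_avoiding_forbidden[of "{5}"] by simp
  have f126: "?F {1,2,6} = 1 + ?x * ?F {1,5}"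
    using gf_avoiding_forbidden[of "{1,5}"] by (simp add: numeral_2_eq_2)
  have f136: "?F {1,3,6} = 1 + ?x * ?F {2,5}"
    using gf_avoiding_forbidden[of "{2,5}"] by simp
  have f146: "?F {1,4,6} = 1 + ?x * ?F {3,5}"
    using gf_avoiding_forbidden[of "{3,5}"] by simp
  have f135: "?F {1,3,5} = 1 + ?x * ?F {2,4}"
    using gf_avoiding_forbidden[of "{2,4}"] by simp
  have f1246: "?F {1,2,4,6} = 1 + ?x * ?F {1,3,5}"
    using gf_avoiding_forbidden[of "{1,3,5}"] by (simp add: numeral_2_eq_2)
  \<comment> \<open>the eight reachable sets that do not contain 1\<close>
  have e: "?F {} = 1 + ?x * (?F {} + ?F {1,6})"
    using gf_avoiding_allowed[of "{}"] by simp
  have d: "?F {5} = 1 + ?x * (?F {4} + ?F {1,4,6})"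
    using gf_avoiding_allowed[of "{4}"] by (simp add: insert_commute)
  have c: "?F {4} = 1 + ?x * (?F {3} + ?F {1,3,6})"
    using gf_avoiding_allowed[of "{3}"] by (simp add: insert_commute)
  have b: "?F {3} = 1 + ?x * (?F {2} + ?F {1,2,6})"
    using gf_avoiding_allowed[of "{2}"] by (simp add: insert_commute)
  have a: "?F {2} = 1 + ?x * (?F {1} + ?F {1,6})"
    using gf_avoiding_allowed[of "{1}"] by (simp add: insert_commute numeral_2_eq_2)
  have p: "?F {3,5} = 1 + ?x * (?F {2,4} + ?F {1,2,4,6})"
    using gf_avoiding_allowed[of "{2,4}"] by (simp add: insert_commute)
  have q: "?F {2,5} = 1 + ?x * (?F {1,4} + ?F {1,4,6})"
    using gf_avoiding_allowed[of "{1,4}"] by (simp add: insert_commute numeral_2_eq_2)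
  have r: "?F {2,4} = 1 + ?x * (?F {1,3} + ?F {1,3,6})"
    using gf_avoiding_allowed[of "{1,3}"] by (simp add: insert_commute numeral_2_eq_2)
  note eqs = e[unfolded f16] d[unfolded f146] c[unfolded f136] b[unfolded f126 f15]
    a[unfolded f1 f16] p[unfolded f1246 f135] q[unfolded f14 f146] r[unfolded f13 f136]
  have "D_fps * ?F {} - A_fps = 0"
    unfolding D_fps_def A_fps_def
      cramer_identity[where x = ?x and e = "?F {}" and d = "?F {5}" and c = "?F {4}"
        and b = "?F {3}" and a = "?F {2}" and p = "?F {3,5}" and q = "?F {2,5}"
        and r = "?F {2,4}"]
    by (simp only: eqs[symmetric] diff_self mult_zero_right add_0_right)
  moreover have "D_fps \<noteq> 0"
  proof
    assume "D_fps = 0"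
    then have "fps_nth D_fps 0 = 0" by simp
    then show False by (simp add: D_fps_def)
  qed
  ultimately show ?thesis
    unfolding F0 by (metis eq_iff_diff_eq_0 nonzero_mult_div_cancel_left)
qed

end
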